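(* Let $N$ be a group with finite inverse-closed generating set $X$, let $m\ge 1$, let $\phi\in\mathrm{Aut}(N)$ satisfy $\phi^m=\mathrm{id}$, and let $G=N\rtimes_\phi\langle t\rangle$ where $t$ has order $m$ and $t^{-1}xt=\phi(x)$ for all $x\in X$. Suppose that: (i) $\mathsf{Geo}(N,X)$ is regular; (ii) $\phi$ is length-preserving; and (iii) $\mathsf{ConjGeo}_{\phi^{l}}(N,X)=\mathsf{CycGeo}_{\phi^{l}}(N,X)$ for all $0\le l\le m-1$. Then $\mathsf{ConjGeo}(G,\widehat X)$ is regular, where $\widehat X=X\cup\{t^{\pm1}\}$.
   Context: For a group $G$ with finite inverse-closed generating set $X$: $\pi:X^{\ast}\to G$ is the natural projection, $l(w)$ the length of a word, $|g|$ the length of a shortest word over $X$ representing $g$. $\mathsf{Geo}(G,X)=\{w\in X^{\ast}: l(w)=|\pi(w)|\}$. $\mathsf{ConjGeo}(G,X)=\{w\in X^{\ast}: l(w)=\min\{|h|: h\text{ conjugate to }\pi(w)\}\}$. An automorphism $\psi$ of $G$ is length-preserving if $|\psi(\pi(w))|=|\pi(w)|$ for all $w\in X^{\ast}$ (so it permutes the generators and acts on words letter by letter, and has finite order). Elements $u,v\in G$ are $\psi$-conjugate if $u=\psi(x)^{-1}vx$ for some $x\in G$. $\mathsf{ConjGeo}_\psi(G,X)=\{w\in X^{\ast}: l(w)=\min\{|h|: h \text{ is }\psi\text{-conjugate to }\pi(w)\}\}$. If $\psi$ has finite order $d$, a $\psi$-cyclic permutation of $w=x_1\cdots x_n$ is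 any word $\psi^{k}(x_{i+1})\cdots\psi^{k}(x_n)\psi^{k-1}(x_1)\cdots\psi^{k-1}(x_i)$ with $1\le i\le n$, $0\le k\le d-1$. $\mathsf{CycGeo}_\psi(G,X)$ is the set of geodesic words $w$ all of whose $\psi$-cyclic permutations are geodesic. *)

theory Defs
  imports "HOL-Algebra.Generated_Groups" "HOL-Algebra.Multiplicative_Group"
begin

section \<open>Regular languages\<close>

text \<open>A language over the finite alphabet \<open>A\<close> is regular if it is accepted by a (complete)
  deterministic finite automaton. Every finite state set can be renamed into \<^typ>\<open>nat\<close>,
  so fixing that type of states is no restriction.\<close>

definition regular_language :: "'a set \<Rightarrow> 'a list set \<Rightarrow> bool" where
  "regular_language A L \<longleftrightarrow>
     (\<exists>(Q :: nat set) q0 F \<delta>. finite Q \<and> q0 \<in> Q \<and> F \<subseteq> Q \<and> (\<forall>q\<in>Q. \<forall>a\<in>A. \<delta> q a \<in> Q) \<and>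
        L = {w \<in> lists A. foldl \<delta> q0 w \<in> F})"


section \<open>Words and geodesics\<close>

definition inverse_closed_generating_set :: "('a, 'b) monoid_scheme \<Rightarrow> 'a set \<Rightarrow> bool" where
  "inverse_closed_generating_set G X \<longleftrightarrow>
     X \<subseteq> carrier G \<and> (\<forall>x\<in>X. inv\<^bsub>G\<^esub> x \<in> X) \<and> generate G X = carrier G"

definition word_eval :: "('a, 'b) monoid_scheme \<Rightarrow> 'a list \<Rightarrow> 'a" where
  "word_eval G w = foldr (mult G) w \<one>\<^bsub>G\<^esub>"

definition word_length :: "('a, 'b) monoid_scheme \<Rightarrow> 'a set \<Rightarrow> 'a \<Rightarrow> nat" where
  "word_length G X g = (LEAST n. \<exists>w\<in>lists X. word_eval G w = g \<and> length w = n)"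

definition Geo :: "('a, 'b) monoid_scheme \<Rightarrow> 'a set \<Rightarrow> 'a list set" where
  "Geo G X = {w \<in> lists X. length w = word_length G X (word_eval G w)}"


section \<open>Conjugacy and twisted conjugacy\<close>

definition conjugate :: "('a, 'b) monoid_scheme \<Rightarrow> 'a \<Rightarrow> 'a \<Rightarrow> bool" where
  "conjugate G u v \<longleftrightarrow> (\<exists>x\<in>carrier G. u = inv\<^bsub>G\<^esub> x \<otimes>\<^bsub>G\<^esub> v \<otimes>\<^bsub>G\<^esub> x)"

definition twisted_conjugate ::
    "('a, 'b) monoid_scheme \<Rightarrow> ('a \<Rightarrow> 'a) \<Rightarrow> 'a \<Rightarrow> 'a \<Rightarrow> bool" where
  "twisted_conjugate G \<psi> u v \<longleftrightarrow>
     (\<exists>x\<in>carrier G. u = inv\<^bsub>G\<^esub> (\<psi> x) \<otimes>\<^bsub>G\<^esub> v \<otimes>\<^bsub>G\<^esub> x)"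

definition ConjGeo :: "('a, 'b) monoid_scheme \<Rightarrow> 'a set \<Rightarrow> 'a list set" where
  "ConjGeo G X = {w \<in> lists X.
     length w = Inf {word_length G X h | h. conjugate G h (word_eval G w)}}"

definition twisted_ConjGeo ::
    "('a, 'b) monoid_scheme \<Rightarrow> 'a set \<Rightarrow> ('a \<Rightarrow> 'a) \<Rightarrow> 'a list set" where
  "twisted_ConjGeo G X \<psi> = {w \<in> lists X.
     length w = Inf {word_length G X h | h. twisted_conjugate G \<psi> h (word_eval G w)}}"


section \<open>Length-preserving automorphisms and twisted cyclic permutations\<close>

definition length_preserving ::
    "('a, 'b) monoid_scheme \<Rightarrow> 'a set \<Rightarrow> ('a \<Rightarrow> 'a) \<Rightarrow> bool" where
  "length_preserving G X \<psi> \<longleftrightarrow>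
     (\<forall>w\<in>lists X. word_length G X (\<psi> (word_eval G w)) = word_length G X (word_eval G w))"

text \<open>The least \<open>d > 0\<close> with \<open>\<psi>\<^sup>d = id\<close> on the carrier; only meaningful for \<open>\<psi>\<close> of finite order.\<close>

definition aut_order :: "('a, 'b) monoid_scheme \<Rightarrow> ('a \<Rightarrow> 'a) \<Rightarrow> nat" where
  "aut_order G \<psi> = (LEAST d. 0 < d \<and> (\<forall>x\<in>carrier G. (\<psi> ^^ d) x = x))"

text \<open>Integer powers: the exponent \<open>k - 1\<close> in a twisted cyclic permutation is \<open>-1\<close> for \<open>k = 0\<close>.\<close>

definition aut_power :: "('a, 'b) monoid_scheme \<Rightarrow> ('a \<Rightarrow> 'a) \<Rightarrow> int \<Rightarrow> 'a \<Rightarrow> 'a" where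
  "aut_power G \<psi> k =
     (if 0 \<le> k then \<psi> ^^ nat k else inv_into (carrier G) \<psi> ^^ nat (- k))"

definition twisted_cyclic_perms ::
    "('a, 'b) monoid_scheme \<Rightarrow> ('a \<Rightarrow> 'a) \<Rightarrow> 'a list \<Rightarrow> 'a list set" where
  "twisted_cyclic_perms G \<psi> w =
     {map (aut_power G \<psi> (int k)) (drop i w) @ map (aut_power G \<psi> (int k - 1)) (take i w) | i k.
        1 \<le> i \<and> i \<le> length w \<and> k < aut_order G \<psi>}"

definition twisted_CycGeo ::
    "('a, 'b) monoid_scheme \<Rightarrow> 'a set \<Rightarrow> ('a \<Rightarrow> 'a) \<Rightarrow> 'a list set" where
  "twisted_CycGeo G X \<psi> = {w \<in> Geo G X. twisted_cyclic_perms G \<psi> w \<subseteq> Geo G X}"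


section \<open>Semidirect product with a finite cyclic group\<close>

text \<open>For an automorphism \<open>\<phi>\<close> of \<open>N\<close> with \<open>\<phi>\<^sup>m = id\<close>, the pair \<open>(k, x)\<close> stands for \<open>t\<^sup>k x\<close>.
  Since \<open>t\<^sup>-\<^sup>1 x t = \<phi>(x)\<close>, we have \<open>(t\<^sup>k x) (t\<^sup>l y) = t\<^sup>k\<^sup>+\<^sup>l \<phi>\<^sup>l(x) y\<close>.\<close>

definition cyclic_semidirect ::
    "('a, 'b) monoid_scheme \<Rightarrow> ('a \<Rightarrow> 'a) \<Rightarrow> nat \<Rightarrow> (nat \<times> 'a) monoid" where
  "cyclic_semidirect N \<phi> m =
     \<lparr>carrier = {0..<m} \<times> carrier N,
      mult = (\<lambda>(k, x) (l, y). ((k + l) mod m, (\<phi> ^^ l) x \<otimes>\<^bsub>N\<^esub> y)),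
      one = (0, \<one>\<^bsub>N\<^esub>)\<rparr>"

definition base_embed :: "'a \<Rightarrow> nat \<times> 'a" where
  "base_embed x = (0, x)"

text \<open>The generator \<open>t\<close>; for \<open>m = 1\<close> it is the identity.\<close>

definition stable_letter :: "('a, 'b) monoid_scheme \<Rightarrow> nat \<Rightarrow> nat \<times> 'a" where
  "stable_letter N m = (1 mod m, \<one>\<^bsub>N\<^esub>)"

definition extended_generators ::
    "('a, 'b) monoid_scheme \<Rightarrow> ('a \<Rightarrow> 'a) \<Rightarrow> nat \<Rightarrow> 'a set \<Rightarrow> (nat \<times> 'a) set" where
  "extended_generators N \<phi> m X =
     base_embed ` X \<union>
     {stable_letter N m, inv\<^bsub>cyclic_semidirect N \<phi> m\<^esub> (stable_letter N m)}"

text \<open>These facts characterise \<^const>\<open>cyclic_semidirect\<close> as the semidirect product of \<open>N\<close> with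
  \<open>\<langle>t\<rangle>\<close>, where \<open>t\<close> has order \<open>m\<close> and acts by \<open>t\<^sup>-\<^sup>1 x t = \<phi>(x)\<close>.\<close>

context
  fixes N :: "('a, 'b) monoid_scheme" and \<phi> :: "'a \<Rightarrow> 'a" and m :: nat
  assumes grp: "group N" and iso: "\<phi> \<in> iso N N" and m: "1 \<le> m"
    and period: "\<forall>x\<in>carrier N. (\<phi> ^^ m) x = x"
begin

interpretation N: group N by (rule grp)

lemma phi_power_closed: "x \<in> carrier N \<Longrightarrow> (\<phi> ^^ k) x \<in> carrier N"
  using iso by (induction k) (auto simp: iso_def hom_def)

lemma phi_power_mult:
  "x \<in> carrier N \<Longrightarrow> y \<in> carrier N \<Longrightarrow>
    (\<phi> ^^ k) (x \<otimes>\<^bsub>N\<^esub> y) = (\<phi> ^^ k) x \<otimes>\<^bsub>N\<^esub> (\<phi> ^^ k) y"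
proof (induction k)
  case (Suc k)
  then show ?case using iso phi_power_closed by (simp add: iso_def hom_def)
qed simp

lemma phi_power_one: "(\<phi> ^^ k) \<one>\<^bsub>N\<^esub> = \<one>\<^bsub>N\<^esub>"
proof (induction k)
  case (Suc k)
  have "\<phi> \<in> hom N N" using iso by (simp add: iso_def)
  then have "\<phi> \<one>\<^bsub>N\<^esub> = \<one>\<^bsub>N\<^esub>" using grp by (simp add: hom_one)
  with Suc show ?case by simp
qed simp

lemma phi_power_mod: "x \<in> carrier N \<Longrightarrow> (\<phi> ^^ (k mod m)) x = (\<phi> ^^ k) x"
proof -
  assume x: "x \<in> carrier N"
  have per: "(\<phi> ^^ (m * j)) x = x" for j
  proof (induction j)
    case (Suc j)
    then show ?case using period x by (simp add: funpow_add)
  qed simp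
  have "(\<phi> ^^ k) x = (\<phi> ^^ (k mod m + m * (k div m))) x" by simp
  also have "\<dots> = (\<phi> ^^ (k mod m)) ((\<phi> ^^ (m * (k div m))) x)"
    by (simp only: funpow_add o_apply)
  finally show ?thesis by (simp add: per)
qed

lemma group_cyclic_semidirect: "group (cyclic_semidirect N \<phi> m)"
proof (rule groupI)
  fix a b c
  assume "a \<in> carrier (cyclic_semidirect N \<phi> m)" "b \<in> carrier (cyclic_semidirect N \<phi> m)"
    "c \<in> carrier (cyclic_semidirect N \<phi> m)"
  then obtain k x l y j z where abc: "a = (k, x)" "b = (l, y)" "c = (j, z)"
    and x: "x \<in> carrier N" and y: "y \<in> carrier N" and z: "z \<in> carrier N"
    by (auto simp: cyclic_semidirect_def)
  have "(\<phi> ^^ ((l + j) mod m)) x = (\<phi> ^^ j) ((\<phi> ^^ l) x)"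
    using x by (simp add: phi_power_mod add.commute[of l j] funpow_add)
  then show "a \<otimes>\<^bsub>cyclic_semidirect N \<phi> m\<^esub> b \<otimes>\<^bsub>cyclic_semidirect N \<phi> m\<^esub> c =
      a \<otimes>\<^bsub>cyclic_semidirect N \<phi> m\<^esub> (b \<otimes>\<^bsub>cyclic_semidirect N \<phi> m\<^esub> c)"
    using x y z
    by (simp add: abc cyclic_semidirect_def phi_power_mult phi_power_closed N.m_assoc mod_simps ac_simps)
next
  fix a assume "a \<in> carrier (cyclic_semidirect N \<phi> m)"
  then obtain k x where a: "a = (k, x)" and k: "k < m" and x: "x \<in> carrier N"
    by (auto simp: cyclic_semidirect_def)
  have "(\<phi> ^^ k) ((\<phi> ^^ (m - k)) (inv\<^bsub>N\<^esub> x)) = (\<phi> ^^ (k + (m - k))) (inv\<^bsub>N\<^esub> x)"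
    by (simp only: funpow_add o_apply)
  then have "(\<phi> ^^ k) ((\<phi> ^^ (m - k)) (inv\<^bsub>N\<^esub> x)) = inv\<^bsub>N\<^esub> x"
    using k x period by simp
  then show "\<exists>b\<in>carrier (cyclic_semidirect N \<phi> m).
      b \<otimes>\<^bsub>cyclic_semidirect N \<phi> m\<^esub> a = \<one>\<^bsub>cyclic_semidirect N \<phi> m\<^esub>"
    using k x m
    by (intro bexI[of _ "((m - k) mod m, (\<phi> ^^ (m - k)) (inv\<^bsub>N\<^esub> x))"])
       (auto simp: a cyclic_semidirect_def phi_power_closed mod_simps)
qed (use m in \<open>auto simp: cyclic_semidirect_def phi_power_one phi_power_closed\<close>)

interpretation G: group "cyclic_semidirect N \<phi> m" by (rule group_cyclic_semidirect)

lemma base_embed_hom: "base_embed \<in> hom N (cyclic_semidirect N \<phi> m)"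
  using m by (auto simp: hom_def base_embed_def cyclic_semidirect_def)

lemma inj_base_embed: "inj base_embed"
  by (auto simp: inj_def base_embed_def)

lemma stable_letter_closed: "stable_letter N m \<in> carrier (cyclic_semidirect N \<phi> m)"
  using m by (auto simp: stable_letter_def cyclic_semidirect_def)

lemma stable_letter_power:
  "stable_letter N m [^]\<^bsub>cyclic_semidirect N \<phi> m\<^esub> (k :: nat) = (k mod m, \<one>\<^bsub>N\<^esub>)"
  by (induction k)
     (simp_all add: cyclic_semidirect_def stable_letter_def phi_power_one mod_simps)

lemma stable_letter_order: "group.ord (cyclic_semidirect N \<phi> m) (stable_letter N m) = m"
proof -
  have "stable_letter N m [^]\<^bsub>cyclic_semidirect N \<phi> m\<^esub> k = \<one>\<^bsub>cyclic_semidirect N \<phi> m\<^esub>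
      \<longleftrightarrow> m dvd k" for k :: nat
    unfolding stable_letter_power by (auto simp: cyclic_semidirect_def)
  then show ?thesis
    by (metis G.pow_eq_id stable_letter_closed dvd_antisym dvd_refl)
qed

lemma stable_letter_conj:
  assumes x: "x \<in> carrier N"
  shows "inv\<^bsub>cyclic_semidirect N \<phi> m\<^esub> (stable_letter N m)
      \<otimes>\<^bsub>cyclic_semidirect N \<phi> m\<^esub> base_embed x
      \<otimes>\<^bsub>cyclic_semidirect N \<phi> m\<^esub> stable_letter N m = base_embed (\<phi> x)"
proof -
  have bx: "base_embed y \<in> carrier (cyclic_semidirect N \<phi> m)" if "y \<in> carrier N" for y
    using base_embed_hom that by (auto simp: hom_def)
  have \<phi>x: "\<phi> x \<in> carrier N" using phi_power_closed[OF x, of 1] by simp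
  have "(\<phi> ^^ (1 mod m)) x = \<phi> x" using phi_power_mod[OF x, of 1] by simp
  then have "base_embed x \<otimes>\<^bsub>cyclic_semidirect N \<phi> m\<^esub> stable_letter N m =
      stable_letter N m \<otimes>\<^bsub>cyclic_semidirect N \<phi> m\<^esub> base_embed (\<phi> x)"
    using \<phi>x by (simp add: cyclic_semidirect_def base_embed_def stable_letter_def)
  then show ?thesis
    using bx[OF x] bx[OF \<phi>x] stable_letter_closed
    by (simp add: G.m_assoc G.inv_solve_left')
qed

lemma cyclic_semidirect_normal_form:
  assumes "k < m" "x \<in> carrier N"
  shows "stable_letter N m [^]\<^bsub>cyclic_semidirect N \<phi> m\<^esub> k
      \<otimes>\<^bsub>cyclic_semidirect N \<phi> m\<^esub> base_embed x = (k, x)"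
  using assms unfolding stable_letter_power
  by (simp add: cyclic_semidirect_def base_embed_def)

end

end

theory Submission
  imports Defs
begin

text \<open>
  Every letter \<open>t\<close> or \<open>t\<^sup>-\<^sup>1\<close> of a word \<open>w\<close> over the extended generators can be moved to the left end,
  at the price of applying a power of \<open>\<phi>\<close> to the letters of \<open>X\<close> that it passes. As \<open>\<phi>\<close> preserves
  lengths, it permutes \<open>X\<close>, so the number of letters of each kind does not change: \<open>w\<close> represents
  \<open>t\<^sup>k x\<close>, where \<open>x\<close> is the value of a word \<open>w'\<close> over \<open>X\<close> (called \<open>base_word w\<close> below). It follows
  that the length of \<open>t\<^sup>k x\<close> is \<open>min k (m - k)\<close> plus the length of \<open>x\<close> in \<open>N\<close>
  (lemma \<open>word_length_G\<close>).

  Conjugation by \<open>t\<^sup>l y\<close> fixes the exponent \<open>k\<close> and replaces \<open>x\<close> by a \<open>\<phi>\<^sup>k\<close>-conjugate of \<open>\<phi>\<^sup>l(x)\<close>.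
  Since \<open>\<phi>\<^sup>l\<close> commutes with \<open>\<phi>\<^sup>k\<close> and preserves lengths, the least length in the conjugacy class of
  \<open>t\<^sup>k x\<close> is \<open>min k (m - k)\<close> plus the least length in the \<open>\<phi>\<^sup>k\<close>-twisted class of \<open>x\<close>. Neither summand
  can exceed the number of letters of its kind in \<open>w\<close>, so \<open>w\<close> is a conjugacy geodesic exactly when
  \<open>w\<close> has \<open>min k (m - k)\<close> letters \<open>t\<^sup>\<plusminus>\<^sup>1\<close> and \<open>w'\<close> is a \<open>\<phi>\<^sup>k\<close>-twisted conjugacy geodesic
  (lemma \<open>ConjGeo_G_iff\<close>). By hypothesis the latter says that \<open>w'\<close> is \<open>\<phi>\<^sup>k\<close>-cyclically geodesic, which
  means that \<open>\<phi>\<^sup>k(v) u\<close> is geodesic for each factorisation \<open>w' = u v\<close> (lemma \<open>twisted_CycGeo_iff\<close>).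

  A finite amount of information decides this and can be updated letter by letter. Call two words
  equivalent if they have the same contexts with respect to the regular language of geodesics, that
  is, if they are syntactically congruent; there are finitely many classes. Whether \<open>\<phi>\<^sup>k(v) u\<close> is
  geodesic depends only on the classes of \<open>u\<close> and \<open>v\<close>, because \<open>\<phi>\<close> permutes the geodesics and hence
  acts on the classes. So it suffices to remember \<open>k\<close>, the number of letters \<open>t\<^sup>\<plusminus>\<^sup>1\<close> cut off at \<open>m\<close>,
  and the set of pairs of classes of \<open>u\<close> and \<open>v\<close> over all factorisations \<open>w' = u v\<close>. Appending a
  letter \<open>t\<^sup>\<plusminus>\<^sup>1\<close> applies \<open>\<phi>\<^sup>\<plusminus>\<^sup>1\<close> to this set of pairs, and appending \<open>x \<in> X\<close> extends the second
  components and adds the pair for \<open>u = w' x\<close>. The language is therefore a union of classes of a right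
  invariant equivalence of finite index.
\<close>

section \<open>Regular languages and contexts\<close>

text \<open>The easy half of the Myhill--Nerode theorem: the values of \<open>f\<close> serve as the states. They are
  numbered because the automata considered here have natural numbers as states.\<close>

lemma regular_language_if_right_invariant:
  fixes f :: "'a list \<Rightarrow> 's"
  assumes fin: "finite (f ` lists A)" and L: "L \<subseteq> lists A"
    and snoc: "\<And>u v a. u \<in> lists A \<Longrightarrow> v \<in> lists A \<Longrightarrow> a \<in> A \<Longrightarrow> f u = f v \<Longrightarrow>
      f (u @ [a]) = f (v @ [a])"
    and sat: "\<And>u v. u \<in> lists A \<Longrightarrow> v \<in> lists A \<Longrightarrow> f u = f v \<Longrightarrow> u \<in> L \<Longrightarrow> v \<in> L"
  shows "regular_language A L"
proof -
  obtain enc :: "'s \<Rightarrow> nat" where enc: "inj_on enc (f ` lists A)"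
    using finite_imp_inj_to_nat_seg[OF fin] by blast
  define c where "c w = enc (f w)" for w
  have c_eq: "f u = f v" if "u \<in> lists A" "v \<in> lists A" "c u = c v" for u v
    using inj_onD[OF enc, of "f u" "f v"] that by (simp add: c_def)
  define rep where "rep n = (SOME w. w \<in> lists A \<and> c w = n)" for n
  have rep: "rep (c w) \<in> lists A \<and> c (rep (c w)) = c w" if "w \<in> lists A" for w
    unfolding rep_def by (rule someI[of _ w]) (use that in simp)
  define \<delta> where "\<delta> n a = c (rep n @ [a])" for n a
  have \<delta>: "\<delta> (c w) a = c (w @ [a])" if w: "w \<in> lists A" and a: "a \<in> A" for w a
  proof -
    have "f (rep (c w)) = f w" using rep[OF w] w c_eq by blast
    then have "f (rep (c w) @ [a]) = f (w @ [a])" using snoc rep[OF w] w a by blast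
    then show ?thesis by (simp add: \<delta>_def c_def)
  qed
  have run: "foldl \<delta> (c []) w = c w" if "w \<in> lists A" for w
    using that by (induction w rule: rev_induct) (auto simp: \<delta>)
  have mem: "w \<in> L" if w: "w \<in> lists A" and cw: "c w \<in> c ` L" for w
  proof -
    obtain u where u: "u \<in> L" "c w = c u" using cw by blast
    then have "u \<in> lists A" using L by blast
    then show ?thesis using sat[of u w] c_eq[of u w] u w by simp
  qed
  show ?thesis
    unfolding regular_language_def
  proof (intro exI conjI)
    show "finite (c ` lists A)"
      using fin by (simp add: c_def image_image[symmetric, of enc f])
    show "\<forall>q\<in>c ` lists A. \<forall>a\<in>A. \<delta> q a \<in> c ` lists A"
      by (auto simp: \<delta>)
    show "L = {w \<in> lists A. foldl \<delta> (c []) w \<in> c ` L}"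
    proof (intro equalityI subsetI)
      fix w assume "w \<in> L"
      then show "w \<in> {w \<in> lists A. foldl \<delta> (c []) w \<in> c ` L}" using L run by (simp add: subsetD)
    next
      fix w assume "w \<in> {w \<in> lists A. foldl \<delta> (c []) w \<in> c ` L}"
      then show "w \<in> L" using run[of w] mem[of w] by simp
    qed
  qed (use L in auto)
qed

text \<open>Two words have the same contexts exactly if they are syntactically congruent with respect to
  \<open>L\<close>; the set of contexts represents the class in the syntactic monoid.\<close>

definition contexts :: "'a set \<Rightarrow> 'a list set \<Rightarrow> 'a list \<Rightarrow> ('a list \<times> 'a list) set" where
  "contexts A L u = {(p, q). p \<in> lists A \<and> q \<in> lists A \<and> p @ u @ q \<in> L}"

text \<open>The contexts of a word are determined by the transformation of the states that it induces, and
  a finite automaton has finitely many such transformations.\<close>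

lemma finite_contexts:
  assumes "regular_language A L"
  shows "finite (contexts A L ` lists A)"
proof -
  obtain Q :: "nat set" and q0 F \<delta> where Q: "finite Q" "q0 \<in> Q"
    and \<delta>: "\<forall>q\<in>Q. \<forall>a\<in>A. \<delta> q a \<in> Q" and L: "L = {w \<in> lists A. foldl \<delta> q0 w \<in> F}"
    using assms unfolding regular_language_def by blast
  define R where "R u = {(q, foldl \<delta> q u) | q. q \<in> Q}" for u
  have run: "foldl \<delta> q u \<in> Q" if "q \<in> Q" "u \<in> lists A" for q u
    using that(2,1) \<delta> by (induction u arbitrary: q) auto
  have eq: "contexts A L u = contexts A L v" if u: "u \<in> lists A" and v: "v \<in> lists A"
    and R: "R u = R v" for u v
  proof -
    have same: "foldl \<delta> q u = foldl \<delta> q v" if "q \<in> Q" for q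
    proof -
      have "(q, foldl \<delta> q u) \<in> R v" using that R by (auto simp: R_def)
      then show ?thesis by (auto simp: R_def)
    qed
    have "p @ u @ q \<in> L \<longleftrightarrow> p @ v @ q \<in> L" if "p \<in> lists A" "q \<in> lists A" for p q
      using that u v same[OF run[OF Q(2) that(1)]] by (simp add: L)
    then show ?thesis by (auto simp: contexts_def)
  qed
  have "contexts A L u = contexts A L (SOME v. v \<in> lists A \<and> R v = R u)" if "u \<in> lists A" for u
  proof -
    have "(SOME v. v \<in> lists A \<and> R v = R u) \<in> lists A \<and> R (SOME v. v \<in> lists A \<and> R v = R u) = R u"
      by (rule someI[of _ u]) (use that in simp)
    then show ?thesis using eq that by metis
  qed
  then have "contexts A L ` lists A \<subseteq>
      (\<lambda>r. contexts A L (SOME v. v \<in> lists A \<and> R v = r)) ` R ` lists A"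
    by auto
  moreover have "R ` lists A \<subseteq> Pow (Q \<times> Q)" using run by (auto simp: R_def)
  then have "finite (R ` lists A)" by (rule finite_subset) (simp add: Q)
  ultimately show ?thesis by (meson finite_imageI finite_subset)
qed

lemma contexts_append:
  assumes "u \<in> lists A" "u' \<in> lists A" "v \<in> lists A" "v' \<in> lists A"
    and "contexts A L u = contexts A L u'" "contexts A L v = contexts A L v'"
  shows "contexts A L (u @ v) = contexts A L (u' @ v')"
proof -
  have u: "p @ u @ q \<in> L \<longleftrightarrow> p @ u' @ q \<in> L" if "p \<in> lists A" "q \<in> lists A" for p q
    using that assms(5) by (auto simp: contexts_def)
  have v: "p @ v @ q \<in> L \<longleftrightarrow> p @ v' @ q \<in> L" if "p \<in> lists A" "q \<in> lists A" for p q
    using that assms(6) by (auto simp: contexts_def)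
  have "p @ (u @ v) @ q \<in> L \<longleftrightarrow> p @ (u' @ v') @ q \<in> L" if p: "p \<in> lists A" and q: "q \<in> lists A" for p q
    using u[OF p, of "v @ q"] v[of "p @ u'" q] p q assms(1-4) by simp
  then show ?thesis by (auto simp: contexts_def)
qed

lemma mem_iff_contexts: "w \<in> L \<longleftrightarrow> ([], []) \<in> contexts A L w"
  by (simp add: contexts_def)

text \<open>A letter permutation that preserves \<open>L\<close> transports contexts, so it acts on the syntactic
  classes: the class of a word determines the classes of its images under all powers of an
  automorphism.\<close>

lemma contexts_map:
  assumes g: "g ` A = A" and L: "\<And>w. w \<in> lists A \<Longrightarrow> map g w \<in> L \<longleftrightarrow> w \<in> L"
    and u: "u \<in> lists A"
  shows "contexts A L (map g u) = map_prod (map g) (map g) ` contexts A L u"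
proof -
  have lists: "map g ` lists A = lists A" by (simp add: g flip: lists_image)
  have gm: "map g p \<in> lists A" if "p \<in> lists A" for p using imageI[OF that, of "map g"] lists by simp
  have key: "map g p @ map g u @ map g q \<in> L \<longleftrightarrow> p @ u @ q \<in> L"
    if "p \<in> lists A" "q \<in> lists A" for p q
    using L[of "p @ u @ q"] that u by simp
  show ?thesis
  proof (intro equalityI subsetI)
    fix z assume "z \<in> contexts A L (map g u)"
    then obtain p q where z: "z = (p, q)" and pq: "p \<in> lists A" "q \<in> lists A" "p @ map g u @ q \<in> L"
      by (auto simp: contexts_def)
    have "p \<in> map g ` lists A" "q \<in> map g ` lists A" using pq(1,2) by (simp_all add: lists)
    then obtain p' q' where "p' \<in> lists A" "p = map g p'" "q' \<in> lists A" "q = map g q'"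
      by (elim imageE)
    then show "z \<in> map_prod (map g) (map g) ` contexts A L u"
      using key pq(3) z by (force simp: contexts_def)
  next
    fix z assume "z \<in> map_prod (map g) (map g) ` contexts A L u"
    then show "z \<in> contexts A L (map g u)"
      using key gm by (auto simp: contexts_def)
  qed
qed

text \<open>What a finite automaton can remember about all ways of cutting the word read so far in two.\<close>

definition split_contexts ::
    "'a set \<Rightarrow> 'a list set \<Rightarrow> 'a list \<Rightarrow> (('a list \<times> 'a list) set \<times> ('a list \<times> 'a list) set) set" where
  "split_contexts A L w = {(contexts A L u, contexts A L v) | u v. u @ v = w}"

lemma finite_split_contexts:
  assumes "regular_language A L"
  shows "finite (split_contexts A L ` lists A)"
proof (rule finite_subset)
  show "split_contexts A L ` lists A \<subseteq> Pow (contexts A L ` lists A \<times> contexts A L ` lists A)"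
    by (force simp: split_contexts_def)
qed (simp add: finite_contexts[OF assms])

lemma split_contexts_obtain:
  assumes "split_contexts A L (u @ v) \<subseteq> split_contexts A L w"
  obtains u' v' where "u' @ v' = w" "contexts A L u = contexts A L u'" "contexts A L v = contexts A L v'"
proof -
  have "(contexts A L u, contexts A L v) \<in> split_contexts A L w"
    using assms unfolding split_contexts_def by blast
  then show thesis using that by (auto simp: split_contexts_def)
qed

text \<open>With \<open>split_contexts_map\<close> below, this makes an automaton out of split contexts: equal sets
  stay equal when the words are extended or relabelled. The inclusions, applied in both directions,
  give these equalities.\<close>

lemma split_contexts_snoc:
  assumes w: "w \<in> lists A" and w': "w' \<in> lists A" and a: "a \<in> A"
    and sub: "split_contexts A L w \<subseteq> split_contexts A L w'"
  shows "split_contexts A L (w @ [a]) \<subseteq> split_contexts A L (w' @ [a])"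
proof
  fix z assume "z \<in> split_contexts A L (w @ [a])"
  then obtain u v where z: "z = (contexts A L u, contexts A L v)" and uv: "u @ v = w @ [a]"
    by (auto simp: split_contexts_def)
  show "z \<in> split_contexts A L (w' @ [a])"
  proof (cases v rule: rev_cases)
    case Nil
    \<comment> \<open>The cut after the new letter: the class of the whole old word is needed, and it is the product of
      the two classes of any of its cuts.\<close>
    obtain u' v' where s: "u' @ v' = w'" "contexts A L w = contexts A L u'"
        "contexts A L [] = contexts A L v'"
      using split_contexts_obtain[of A L w "[]" w'] sub by auto
    have "contexts A L ((w @ []) @ [a]) = contexts A L ((u' @ v') @ [a])"
      using s w w' a by (intro contexts_append) auto
    then have "contexts A L u = contexts A L (w' @ [a])" using s uv Nil by simp
    then show ?thesis using z Nil by (auto simp: split_contexts_def)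
  next
    case (snoc v0 b)
    then have "u @ v0 = w" "b = a" using uv by auto
    then obtain u' v' where s: "u' @ v' = w'" "contexts A L u = contexts A L u'"
        "contexts A L v0 = contexts A L v'"
      using split_contexts_obtain[of A L u v0 w'] sub by auto
    have "contexts A L (v0 @ [a]) = contexts A L (v' @ [a])"
      using s w w' a \<open>u @ v0 = w\<close> by (intro contexts_append) auto
    then have "z = (contexts A L u', contexts A L (v' @ [a]))" using z snoc s \<open>b = a\<close> by simp
    moreover have "u' @ (v' @ [a]) = w' @ [a]" using s by simp
    ultimately show ?thesis unfolding split_contexts_def by blast
  qed
qed

lemma split_contexts_map:
  assumes g: "g ` A = A" and L: "\<And>w. w \<in> lists A \<Longrightarrow> map g w \<in> L \<longleftrightarrow> w \<in> L"
    and w: "w \<in> lists A" and w': "w' \<in> lists A"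
    and sub: "split_contexts A L w \<subseteq> split_contexts A L w'"
  shows "split_contexts A L (map g w) \<subseteq> split_contexts A L (map g w')"
proof
  fix z assume "z \<in> split_contexts A L (map g w)"
  then obtain u0 v0 where z: "z = (contexts A L u0, contexts A L v0)" and "map g w = u0 @ v0"
    by (auto simp: split_contexts_def)
  then obtain u v where uv: "w = u @ v" "u0 = map g u" "v0 = map g v"
    by (auto simp: map_eq_append_conv)
  then obtain u' v' where s: "u' @ v' = w'" "contexts A L u = contexts A L u'"
      "contexts A L v = contexts A L v'"
    using split_contexts_obtain[of A L u v w'] sub by auto
  have "u \<in> lists A" "v \<in> lists A" "u' \<in> lists A" "v' \<in> lists A"
    using s(1) uv(1) w w' by auto
  then have "contexts A L u0 = contexts A L (map g u')" "contexts A L v0 = contexts A L (map g v')"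
    using s uv by (simp_all only: contexts_map[OF g L])
  then show "z \<in> split_contexts A L (map g w')"
    using z s(1) by (auto simp: split_contexts_def)
qed

text \<open>The split contexts decide whether all twisted rotations of a word lie in \<open>L\<close>, since the class of
  \<open>map g v @ u\<close> depends only on those of \<open>u\<close> and \<open>v\<close>.\<close>

lemma split_contexts_rotations:
  assumes g: "g ` A = A" and L: "\<And>w. w \<in> lists A \<Longrightarrow> map g w \<in> L \<longleftrightarrow> w \<in> L"
    and w: "w \<in> lists A" and w': "w' \<in> lists A"
    and sub: "split_contexts A L w' \<subseteq> split_contexts A L w"
    and rot: "\<And>u v. u @ v = w \<Longrightarrow> map g v @ u \<in> L"
    and uv: "u @ v = w'"
  shows "map g v @ u \<in> L"
proof -
  obtain u' v' where s: "u' @ v' = w" "contexts A L u = contexts A L u'"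
      "contexts A L v = contexts A L v'"
    using split_contexts_obtain[of A L u v w] sub uv by auto
  have mem: "u \<in> lists A" "v \<in> lists A" "u' \<in> lists A" "v' \<in> lists A"
    using s(1) uv w w' by auto
  have "map g x \<in> lists A" if "x \<in> lists A" for x
    using imageI[OF that, of "map g"] g by (simp flip: lists_image)
  then have "contexts A L (map g v @ u) = contexts A L (map g v' @ u')"
    using s mem by (intro contexts_append) (simp_all only: contexts_map[OF g L])
  then show ?thesis using rot[OF s(1)] by (metis mem_iff_contexts)
qed

section \<open>Words and lengths in a group\<close>

lemma (in group) word_eval_closed: "w \<in> lists (carrier G) \<Longrightarrow> word_eval G w \<in> carrier G"
  by (induction w) (auto simp: word_eval_def)

lemma word_eval_Nil: "word_eval G [] = \<one>\<^bsub>G\<^esub>"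
  and word_eval_Cons: "word_eval G (x # w) = x \<otimes>\<^bsub>G\<^esub> word_eval G w"
  by (simp_all add: word_eval_def)

lemma (in group) word_eval_append:
  "u \<in> lists (carrier G) \<Longrightarrow> v \<in> lists (carrier G) \<Longrightarrow>
    word_eval G (u @ v) = word_eval G u \<otimes> word_eval G v"
  by (induction u)
    (auto simp: word_eval_Nil word_eval_Cons m_assoc word_eval_closed simp flip: in_lists_conv_set)

lemma (in group) word_eval_surj:
  assumes X: "inverse_closed_generating_set G X" and g: "g \<in> carrier G"
  shows "\<exists>w\<in>lists X. word_eval G w = g"
proof -
  have XC: "X \<subseteq> carrier G" and inv: "\<And>x. x \<in> X \<Longrightarrow> inv x \<in> X"
    using X by (auto simp: inverse_closed_generating_set_def)
  have "g \<in> generate G X" using X g by (simp add: inverse_closed_generating_set_def)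
  then show ?thesis
  proof (induction rule: generate.induct)
    case one
    then show ?case by (intro bexI[of _ "[]"]) (auto simp: word_eval_Nil)
  next
    case (incl h)
    then show ?case using XC by (intro bexI[of _ "[h]"]) (auto simp: word_eval_Nil word_eval_Cons)
  next
    case (inv h)
    then show ?case using XC \<open>\<And>x. x \<in> X \<Longrightarrow> inv x \<in> X\<close>
      by (intro bexI[of _ "[inv h]"]) (auto simp: word_eval_Nil word_eval_Cons)
  next
    case (eng h1 h2)
    then obtain u v where "u \<in> lists X" "v \<in> lists X" "word_eval G u = h1" "word_eval G v = h2"
      by blast
    then show ?case using XC
      by (intro bexI[of _ "u @ v"]) (auto intro!: word_eval_append)
  qed
qed

lemma word_length_le: "w \<in> lists X \<Longrightarrow> word_length G X (word_eval G w) \<le> length w"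
  unfolding word_length_def by (rule Least_le) blast

lemma word_length_attained:
  assumes "w \<in> lists X" "word_eval G w = g"
  obtains v where "v \<in> lists X" "word_eval G v = g" "length v = word_length G X g"
  using LeastI[of "\<lambda>n. \<exists>w\<in>lists X. word_eval G w = g \<and> length w = n" "length w"] assms
  unfolding word_length_def by blast

lemma Inf_nat_add_image:
  fixes A :: "nat set"
  assumes "A \<noteq> {}"
  shows "Inf ((+) c ` A) = c + Inf A"
proof (rule antisym)
  have "Inf A \<in> A" using assms by (rule Inf_nat_def1)
  then show "Inf ((+) c ` A) \<le> c + Inf A" by (intro cInf_lower) auto
  show "c + Inf A \<le> Inf ((+) c ` A)"
    using assms by (intro cInf_greatest) (auto intro: cInf_lower)
qed

section \<open>The semidirect product\<close>

locale cyclic_extension = N: group N for N :: "('a, 'b) monoid_scheme" +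
  fixes X :: "'a set" and m :: nat and \<phi> :: "'a \<Rightarrow> 'a"
  assumes fin: "finite X" and gen: "inverse_closed_generating_set N X"
    and m: "1 \<le> m" and iso: "\<phi> \<in> iso N N" and period: "\<forall>x\<in>carrier N. (\<phi> ^^ m) x = x"
    and lp: "length_preserving N X \<phi>"
begin

abbreviation G where "G \<equiv> cyclic_semidirect N \<phi> m"
abbreviation Y where "Y \<equiv> extended_generators N \<phi> m X"

lemmas power_closed [simp] = phi_power_closed[OF N.is_group iso m period]
lemmas power_mult = phi_power_mult[OF N.is_group iso m period]
lemmas power_one [simp] = phi_power_one[OF N.is_group iso m period]

sublocale G: group G
  by (rule group_cyclic_semidirect[OF N.is_group iso m period])

lemma X_closed: "x \<in> X \<Longrightarrow> x \<in> carrier N"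
  using gen by (auto simp: inverse_closed_generating_set_def)

lemma word_closed: "w \<in> lists X \<Longrightarrow> word_eval N w \<in> carrier N"
  using X_closed by (intro N.word_eval_closed) auto

lemma eval_append:
  "u \<in> lists X \<Longrightarrow> v \<in> lists X \<Longrightarrow> word_eval N (u @ v) = word_eval N u \<otimes>\<^bsub>N\<^esub> word_eval N v"
  using X_closed by (intro N.word_eval_append) auto

lemma power_add: "(\<phi> ^^ (k + l)) x = (\<phi> ^^ k) ((\<phi> ^^ l) x)"
  by (simp add: funpow_add)

text \<open>As \<open>\<phi>\<^sup>m = id\<close>, the inverse of \<open>\<phi>\<^sup>k\<close> is the non-negative power \<open>\<phi>\<close> to the \<open>k (m - 1)\<close>, so that
  natural exponents suffice throughout.\<close>

lemma power_cancel: "x \<in> carrier N \<Longrightarrow> (\<phi> ^^ (k * (m - 1))) ((\<phi> ^^ k) x) = x"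
proof -
  assume x: "x \<in> carrier N"
  have "k * (m - 1) + k = k * m" using m by (cases m) auto
  then have "(\<phi> ^^ (k * (m - 1))) ((\<phi> ^^ k) x) = (\<phi> ^^ (k * m)) x"
    by (metis power_add)
  then show ?thesis
    using phi_power_mod[OF N.is_group iso m period x, of "k * m"] by simp
qed

lemma power_cancel': "x \<in> carrier N \<Longrightarrow> (\<phi> ^^ k) ((\<phi> ^^ (k * (m - 1))) x) = x"
  using power_cancel[of x k] by (simp add: add.commute flip: power_add)

lemma power_inv: "x \<in> carrier N \<Longrightarrow> (\<phi> ^^ k) (inv\<^bsub>N\<^esub> x) = inv\<^bsub>N\<^esub> ((\<phi> ^^ k) x)"
  by (rule N.inv_equality[symmetric]) (simp_all flip: power_mult)

lemma length_power:
  assumes x: "x \<in> carrier N"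
  shows "word_length N X ((\<phi> ^^ k) x) = word_length N X x"
proof (induction k)
  case (Suc k)
  obtain w where "w \<in> lists X" "word_eval N w = (\<phi> ^^ k) x"
    using N.word_eval_surj[OF gen] x by (metis power_closed)
  then have "word_length N X (\<phi> ((\<phi> ^^ k) x)) = word_length N X ((\<phi> ^^ k) x)"
    using lp unfolding length_preserving_def by metis
  then show ?case using Suc by simp
qed simp

lemma inj_power: "inj_on (\<phi> ^^ k) (carrier N)"
  by (rule inj_on_inverseI) (rule power_cancel)

text \<open>The image of a generator has length at most one. If the length is zero, the image and hence
  the generator itself is the identity, which is then an element of \<open>X\<close>. Surjectivity follows from
  injectivity because \<open>X\<close> is finite.\<close>

lemma power_image: "(\<phi> ^^ k) ` X = X"
proof -
  have "(\<phi> ^^ k) x \<in> X" if x: "x \<in> X" for x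
  proof -
    have xc: "x \<in> carrier N" using x X_closed by blast
    have "word_length N X x \<le> 1"
      using word_length_le[of "[x]" X N] x xc by (simp add: word_eval_Nil word_eval_Cons)
    moreover obtain w0 where "w0 \<in> lists X" "word_eval N w0 = (\<phi> ^^ k) x"
      using N.word_eval_surj[OF gen] xc by (metis power_closed)
    then obtain w where w: "w \<in> lists X" "word_eval N w = (\<phi> ^^ k) x"
        "length w = word_length N X ((\<phi> ^^ k) x)"
      by (rule word_length_attained)
    ultimately have "length w \<le> 1" using length_power[OF xc] by simp
    then consider "w = []" | y where "w = [y]" by (cases w) auto
    then show ?thesis
    proof cases
      case 1
      then have "(\<phi> ^^ k) x = (\<phi> ^^ k) \<one>\<^bsub>N\<^esub>" using w(2) word_eval_Nil[of N] power_one by metis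
      then have "x = \<one>\<^bsub>N\<^esub>" using inj_power xc by (meson N.one_closed inj_onD)
      then show ?thesis using x by simp
    next
      case 2
      then show ?thesis using w(1,2) X_closed by (auto simp: word_eval_Nil word_eval_Cons)
    qed
  qed
  then have "(\<phi> ^^ k) ` X \<subseteq> X" by blast
  moreover have "inj_on (\<phi> ^^ k) X" using inj_power X_closed by (meson inj_on_subset subsetI)
  ultimately show ?thesis using fin by (meson endo_inj_surj)
qed

lemma map_power_lists: "w \<in> lists X \<Longrightarrow> map (\<phi> ^^ k) w \<in> lists X"
  using imageI[of w "lists X" "map (\<phi> ^^ k)"] power_image[of k] by (simp flip: lists_image)

lemma eval_map_power:
  "w \<in> lists X \<Longrightarrow> word_eval N (map (\<phi> ^^ k) w) = (\<phi> ^^ k) (word_eval N w)"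
  by (induction w) (auto simp: word_eval_Nil word_eval_Cons power_mult X_closed word_closed
      simp flip: in_lists_conv_set)

lemma Geo_map_power:
  "w \<in> lists X \<Longrightarrow> map (\<phi> ^^ k) w \<in> Geo N X \<longleftrightarrow> w \<in> Geo N X"
  using map_power_lists[of w k] by (simp add: Geo_def eval_map_power length_power word_closed)

section \<open>Twisted cyclic permutations\<close>

text \<open>A twisted cyclic permutation of \<open>u v\<close> with exponent \<open>j\<close> applies the power \<open>j - 1\<close> of the
  automorphism \<open>\<psi> = \<phi>\<^sup>k\<close> to the whole word \<open>\<psi>(v) u\<close>. That power is a power \<open>\<phi>\<^sup>n\<close>, also when
  \<open>j = 0\<close>, and does not affect whether a word is geodesic.\<close>

lemma aut_power_pred:
  "\<exists>n. \<forall>x\<in>carrier N. aut_power N (\<phi> ^^ k) (int j - 1) x = (\<phi> ^^ n) x \<and>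
     aut_power N (\<phi> ^^ k) (int j) x = (\<phi> ^^ n) ((\<phi> ^^ k) x)"
proof (cases j)
  case 0
  have "inv_into (carrier N) (\<phi> ^^ k) x = (\<phi> ^^ (k * (m - 1))) x" if "x \<in> carrier N" for x
    using that inj_power by (intro inv_into_f_eq) (auto simp: power_cancel' simp del: One_nat_def)
  then show ?thesis
    using 0 by (intro exI[of _ "k * (m - 1)"]) (auto simp: aut_power_def power_cancel simp del: One_nat_def)
next
  case (Suc i)
  have pow: "aut_power N (\<phi> ^^ k) (int l) = \<phi> ^^ (k * l)" for l
    by (simp add: aut_power_def funpow_mult)
  have "(\<phi> ^^ (k * j)) x = (\<phi> ^^ (k * i)) ((\<phi> ^^ k) x)" for x
    by (simp add: Suc add.commute flip: power_add)
  moreover have "int j - 1 = int i" using Suc by simp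
  ultimately show ?thesis by (intro exI[of _ "k * i"]) (simp add: pow)
qed

lemma twisted_CycGeo_iff:
  "w \<in> twisted_CycGeo N X (\<phi> ^^ k) \<longleftrightarrow>
     w \<in> lists X \<and> (\<forall>u v. u @ v = w \<longrightarrow> map (\<phi> ^^ k) v @ u \<in> Geo N X)"
proof (cases "w \<in> lists X")
  case True
  let ?rot = "\<lambda>i j. map (aut_power N (\<phi> ^^ k) (int j)) (drop i w) @
      map (aut_power N (\<phi> ^^ k) (int j - 1)) (take i w)"
  have rot: "?rot i j \<in> Geo N X \<longleftrightarrow> map (\<phi> ^^ k) (drop i w) @ take i w \<in> Geo N X" for i j
  proof -
    obtain n where n: "\<forall>x\<in>carrier N. aut_power N (\<phi> ^^ k) (int j - 1) x = (\<phi> ^^ n) x \<and>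
        aut_power N (\<phi> ^^ k) (int j) x = (\<phi> ^^ n) ((\<phi> ^^ k) x)"
      using aut_power_pred by blast
    have mem: "drop i w \<in> lists X" "take i w \<in> lists X"
      using True by (auto dest: in_set_dropD in_set_takeD)
    then have "?rot i j = map (\<phi> ^^ n) (map (\<phi> ^^ k) (drop i w) @ take i w)"
      using n X_closed by auto
    moreover have "map (\<phi> ^^ k) (drop i w) @ take i w \<in> lists X"
      using mem map_power_lists by (meson append_in_lists_conv)
    ultimately show ?thesis using Geo_map_power by metis
  qed
  have "0 < m \<and> (\<forall>x\<in>carrier N. ((\<phi> ^^ k) ^^ m) x = x)"
    using m phi_power_mod[OF N.is_group iso m period, of _ "k * m"] by (simp add: funpow_mult)
  then have ord: "0 < aut_order N (\<phi> ^^ k)"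
    unfolding aut_order_def by (rule LeastI2) simp
  have "w \<in> twisted_CycGeo N X (\<phi> ^^ k) \<longleftrightarrow>
      w \<in> Geo N X \<and> (\<forall>i. 1 \<le> i \<and> i \<le> length w \<longrightarrow> map (\<phi> ^^ k) (drop i w) @ take i w \<in> Geo N X)"
    using ord rot unfolding twisted_CycGeo_def twisted_cyclic_perms_def by blast
  also have "\<dots> \<longleftrightarrow> (\<forall>u v. u @ v = w \<longrightarrow> map (\<phi> ^^ k) v @ u \<in> Geo N X)"
    (is "?L \<longleftrightarrow> ?R")
  proof
    assume L: ?L
    show ?R
    proof (intro allI impI)
      fix u v assume uv: "u @ v = w"
      show "map (\<phi> ^^ k) v @ u \<in> Geo N X"
      proof (cases "u = []")
        case True
        then show ?thesis using L uv Geo_map_power \<open>w \<in> lists X\<close> by simp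
      next
        case False
        then show ?thesis using L uv by (auto dest: spec[of _ "length u"] simp: Suc_le_eq)
      qed
    qed
  next
    assume R: ?R
    \<comment> \<open>The cut with empty second part gives back \<open>w\<close>.\<close>
    then have "w \<in> Geo N X" by (metis append.right_neutral append_Nil list.simps(8))
    with R show ?L by (metis append_take_drop_id)
  qed
  finally show ?thesis using True by blast
qed (auto simp: twisted_CycGeo_def Geo_def)

section \<open>Lengths in the semidirect product\<close>

lemma G_simps:
  "(k, x) \<otimes>\<^bsub>G\<^esub> (l, y) = ((k + l) mod m, (\<phi> ^^ l) x \<otimes>\<^bsub>N\<^esub> y)"
  "\<one>\<^bsub>G\<^esub> = (0, \<one>\<^bsub>N\<^esub>)"
  "(k, x) \<in> carrier G \<longleftrightarrow> k < m \<and> x \<in> carrier N"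
  by (auto simp: cyclic_semidirect_def)

lemma inv_stable_letter: "inv\<^bsub>G\<^esub> (stable_letter N m) = (m - 1, \<one>\<^bsub>N\<^esub>)"
  using m by (intro G.inv_equality)
    (auto simp: stable_letter_def G_simps mod_simps)

lemma Y_eq: "Y = base_embed ` X \<union> {(1 mod m, \<one>\<^bsub>N\<^esub>), (m - 1, \<one>\<^bsub>N\<^esub>)}"
  unfolding extended_generators_def inv_stable_letter by (simp add: stable_letter_def)

lemma Y_closed: "Y \<subseteq> carrier G"
  using m X_closed unfolding Y_eq
  by (auto simp: base_embed_def G_simps(3) simp del: One_nat_def)

text \<open>Moving a letter with \<open>t\<close>-exponent \<open>l\<close> to the left past a word over \<open>X\<close> applies \<open>\<phi>\<^sup>l\<close> to that
  word, because \<open>x t = t \<phi>(x)\<close>. For \<open>m = 1\<close> and \<open>\<one> \<in> X\<close> the letters \<open>t\<close> and \<open>\<one>\<close> coincide; this letter is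
  then counted as an element of \<open>X\<close>.\<close>

definition pull_step :: "'a list \<Rightarrow> nat \<times> 'a \<Rightarrow> 'a list" where
  "pull_step u a = map (\<phi> ^^ fst a) u @ (if a \<in> base_embed ` X then [snd a] else [])"

definition base_word :: "(nat \<times> 'a) list \<Rightarrow> 'a list" where
  "base_word w = foldl pull_step [] w"

definition stable_count :: "(nat \<times> 'a) list \<Rightarrow> nat" where
  "stable_count w = length (filter (\<lambda>a. a \<notin> base_embed ` X) w)"

text \<open>The length of \<open>t\<^sup>k\<close> for \<open>k < m\<close>: the distance from \<open>0\<close> to \<open>k\<close> on a cycle with \<open>m\<close> vertices.\<close>

definition stable_length :: "nat \<Rightarrow> nat" where
  "stable_length k = min k (m - k)"

lemma base_word_snoc: "base_word (w @ [a]) = pull_step (base_word w) a"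
  by (simp add: base_word_def)

lemma length_split: "length w = stable_count w + length (base_word w)"
  by (induction w rule: rev_induct)
    (auto simp: base_word_snoc pull_step_def stable_count_def base_word_def[of "[]"])

lemma base_word_lists: "base_word w \<in> lists X"
proof (induction w rule: rev_induct)
  case (snoc a w)
  then show ?case
    using map_power_lists[OF snoc, of "fst a"]
    by (auto simp: base_word_snoc pull_step_def base_embed_def)
qed (simp add: base_word_def)

lemma eval_Y_closed: "w \<in> lists Y \<Longrightarrow> word_eval G w \<in> carrier G"
  using Y_closed by (intro G.word_eval_closed) auto

lemma eval_Y_snoc:
  assumes "w \<in> lists Y" "a \<in> Y"
  shows "word_eval G (w @ [a]) = word_eval G w \<otimes>\<^bsub>G\<^esub> a"
proof -
  have "word_eval G (w @ [a]) = word_eval G w \<otimes>\<^bsub>G\<^esub> word_eval G [a]"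
    using assms Y_closed by (intro G.word_eval_append) auto
  moreover have "a \<in> carrier G" using assms Y_closed by blast
  ultimately show ?thesis by (simp add: word_eval_Nil word_eval_Cons)
qed

lemma fst_eval_snoc:
  "w \<in> lists Y \<Longrightarrow> a \<in> Y \<Longrightarrow> fst (word_eval G (w @ [a])) = (fst (word_eval G w) + fst a) mod m"
  by (cases "word_eval G w"; cases a) (simp add: eval_Y_snoc G_simps)

lemma snd_eval: "w \<in> lists Y \<Longrightarrow> snd (word_eval G w) = word_eval N (base_word w)"
proof (induction w rule: rev_induct)
  case (snoc a w)
  then have w: "w \<in> lists Y" and a: "a \<in> Y" by auto
  obtain k l x where ev: "word_eval G w = (k, word_eval N (base_word w))" and al: "a = (l, x)"
    using snoc.IH[OF w] by (metis prod.collapse)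
  have xN: "x \<in> carrier N" using a al Y_closed by (auto simp: G_simps)
  have "snd (word_eval G (w @ [a])) = (\<phi> ^^ l) (word_eval N (base_word w)) \<otimes>\<^bsub>N\<^esub> x"
    using w a ev al by (simp add: eval_Y_snoc G_simps)
  also have "\<dots> = word_eval N (base_word (w @ [a]))"
  proof (cases "a \<in> base_embed ` X")
    case True
    then have "x \<in> X" using al by (auto simp: base_embed_def)
    then have "word_eval N (base_word (w @ [a])) = word_eval N (map (\<phi> ^^ l) (base_word w)) \<otimes>\<^bsub>N\<^esub> word_eval N [x]"
      using True al map_power_lists[OF base_word_lists]
      by (simp add: base_word_snoc pull_step_def eval_append)
    then show ?thesis using xN by (simp add: eval_map_power base_word_lists word_eval_Nil word_eval_Cons)
  next
    case False
    then have "x = \<one>\<^bsub>N\<^esub>" using a al by (auto simp: Y_eq)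
    then show ?thesis using False al
      by (simp add: base_word_snoc pull_step_def eval_map_power base_word_lists word_closed)
  qed
  finally show ?case .
qed (simp add: base_word_def word_eval_Nil G_simps)

lemma stable_length_step:
  assumes "k < m" "l \<in> {1 mod m, m - 1}"
  shows "stable_length ((k + l) mod m) \<le> stable_length k + 1"
proof -
  have "(k + (m - 1)) mod m = (if k = 0 then m - 1 else k - 1)"
  proof (cases k)
    case (Suc i)
    then have "k + (m - 1) = i + m" using m by simp
    then show ?thesis using Suc assms(1) by simp
  qed (use m in simp)
  moreover have "(k + 1 mod m) mod m = (if k + 1 = m then 0 else k + 1)"
    using assms(1) by (auto simp: mod_simps)
  ultimately show ?thesis using assms by (auto simp: stable_length_def)
qed

lemma stable_length_le_count:
  "w \<in> lists Y \<Longrightarrow> stable_length (fst (word_eval G w)) \<le> stable_count w"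
proof (induction w rule: rev_induct)
  case (snoc a w)
  then have w: "w \<in> lists Y" and a: "a \<in> Y" by auto
  have k: "fst (word_eval G w) < m"
    using eval_Y_closed[OF w] by (cases "word_eval G w") (simp add: G_simps)
  show ?case
  proof (cases "a \<in> base_embed ` X")
    case True
    then have "fst a = 0" by (auto simp: base_embed_def)
    then show ?thesis using True snoc.IH[OF w] k by (simp add: fst_eval_snoc[OF w a] stable_count_def)
  next
    case False
    then have "fst a \<in> {1 mod m, m - 1}" using a by (auto simp: Y_eq)
    then show ?thesis
      using stable_length_step[OF k] snoc.IH[OF w] False
      by (force simp: fst_eval_snoc[OF w a] stable_count_def)
  qed
qed (simp add: word_eval_Nil G_simps stable_length_def)

lemma eval_replicate:
  assumes "(l, \<one>\<^bsub>N\<^esub>) \<in> Y" "w \<in> lists X"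
  shows "word_eval G (replicate j (l, \<one>\<^bsub>N\<^esub>) @ map base_embed w) = ((j * l) mod m, word_eval N w)"
proof (induction j)
  case 0
  have "word_eval G (map base_embed w) = (0, word_eval N w)"
    using assms(2) by (induction w) (auto simp: word_eval_Nil word_eval_Cons G_simps base_embed_def)
  then show ?case by simp
next
  case (Suc j)
  then show ?case using word_closed[OF assms(2)]
    by (simp add: word_eval_Cons G_simps mod_simps)
qed

text \<open>For the upper bound, a geodesic for \<open>x\<close> is preceded by \<open>k\<close> letters \<open>t\<close> or by \<open>m - k\<close> letters
  \<open>t\<^sup>-\<^sup>1\<close>. For the lower bound, the two kinds of letters of any representing word are counted
  separately.\<close>

lemma word_length_G:
  assumes k: "k < m" and x: "x \<in> carrier N"
  shows "word_length G Y (k, x) = stable_length k + word_length N X x"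
proof -
  obtain w0 where "w0 \<in> lists X" "word_eval N w0 = x" using N.word_eval_surj[OF gen x] by blast
  then obtain w where w: "w \<in> lists X" "word_eval N w = x" "length w = word_length N X x"
    by (rule word_length_attained)
  have "\<exists>l. (l, \<one>\<^bsub>N\<^esub>) \<in> Y \<and> (stable_length k * l) mod m = k"
  proof (cases "k \<le> m - k")
    case True
    then have "(stable_length k * (1 mod m)) mod m = k" using k by (simp add: stable_length_def mod_simps)
    then show ?thesis by (intro exI[of _ "1 mod m"]) (simp add: Y_eq)
  next
    case False
    have "(m - k) * (m - 1) = k + m * (m - k - 1)"
    proof -
      obtain d where "m = k + Suc d" using k less_imp_Suc_add by fastforce
      then show ?thesis by (simp add: algebra_simps)
    qed
    then have "(stable_length k * (m - 1)) mod m = k"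
      using False k by (simp add: stable_length_def del: One_nat_def)
    then show ?thesis by (intro exI[of _ "m - 1"]) (simp add: Y_eq)
  qed
  then obtain l where l: "(l, \<one>\<^bsub>N\<^esub>) \<in> Y" "(stable_length k * l) mod m = k" by blast
  let ?v = "replicate (stable_length k) (l, \<one>\<^bsub>N\<^esub>) @ map base_embed w"
  have v: "?v \<in> lists Y" "word_eval G ?v = (k, x)"
    using l w eval_replicate[OF l(1) w(1)] by (auto simp: Y_eq)
  have "word_length G Y (k, x) \<le> stable_length k + word_length N X x"
    using word_length_le[OF v(1), of G] v(2) w(3) by simp
  moreover obtain u where u: "u \<in> lists Y" "word_eval G u = (k, x)" "length u = word_length G Y (k, x)"
    using v by (rule word_length_attained)
  have "word_length N X x \<le> length (base_word u)"
    using word_length_le[OF base_word_lists, of N u] snd_eval[OF u(1)] u(2) by simp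
  then have "stable_length k + word_length N X x \<le> word_length G Y (k, x)"
    using stable_length_le_count[OF u(1)] length_split[of u] u by simp
  ultimately show ?thesis by simp
qed

section \<open>Conjugacy in the semidirect product\<close>

text \<open>This is the computation \<open>(t\<^sup>l y)\<^sup>-\<^sup>1 t\<^sup>k x (t\<^sup>l y) = t\<^sup>k \<phi>\<^sup>k(y)\<^sup>-\<^sup>1 \<phi>\<^sup>l(x) y\<close>.\<close>

lemma conjugate_G_iff:
  assumes k: "k < m" and x: "x \<in> carrier N"
  shows "conjugate G h (k, x) \<longleftrightarrow>
    (\<exists>z l. h = (k, z) \<and> l < m \<and> twisted_conjugate N (\<phi> ^^ k) z ((\<phi> ^^ l) x))"
proof -
  have solve: "h = inv\<^bsub>G\<^esub> (l, y) \<otimes>\<^bsub>G\<^esub> (k, x) \<otimes>\<^bsub>G\<^esub> (l, y) \<longleftrightarrow>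
      h = (k, inv\<^bsub>N\<^esub> ((\<phi> ^^ k) y) \<otimes>\<^bsub>N\<^esub> (\<phi> ^^ l) x \<otimes>\<^bsub>N\<^esub> y)"
    if l: "l < m" and y: "y \<in> carrier N" for l y
  proof -
    let ?z = "inv\<^bsub>N\<^esub> ((\<phi> ^^ k) y) \<otimes>\<^bsub>N\<^esub> (\<phi> ^^ l) x \<otimes>\<^bsub>N\<^esub> y"
    have mem: "(l, y) \<in> carrier G" "(k, x) \<in> carrier G" "(k, ?z) \<in> carrier G"
      using assms l y by (auto simp: G_simps)
    have "(\<phi> ^^ k) y \<otimes>\<^bsub>N\<^esub> ?z = (\<phi> ^^ l) x \<otimes>\<^bsub>N\<^esub> y"
      using x y by (simp add: N.m_assoc[symmetric])
    then have "(l, y) \<otimes>\<^bsub>G\<^esub> (k, ?z) = (k, x) \<otimes>\<^bsub>G\<^esub> (l, y)"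
      by (simp add: G_simps add.commute)
    then have "(k, ?z) = inv\<^bsub>G\<^esub> (l, y) \<otimes>\<^bsub>G\<^esub> ((k, x) \<otimes>\<^bsub>G\<^esub> (l, y))"
      using mem by (metis G.inv_solve_left G.m_closed)
    then show ?thesis using mem by (metis G.inv_closed G.m_assoc)
  qed
  show ?thesis
  proof
    assume "conjugate G h (k, x)"
    then obtain l y where "l < m" "y \<in> carrier N" "h = inv\<^bsub>G\<^esub> (l, y) \<otimes>\<^bsub>G\<^esub> (k, x) \<otimes>\<^bsub>G\<^esub> (l, y)"
      unfolding conjugate_def by (metis G_simps(3) prod.collapse)
    then show "\<exists>z l. h = (k, z) \<and> l < m \<and> twisted_conjugate N (\<phi> ^^ k) z ((\<phi> ^^ l) x)"
      using solve unfolding twisted_conjugate_def by blast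
  next
    assume "\<exists>z l. h = (k, z) \<and> l < m \<and> twisted_conjugate N (\<phi> ^^ k) z ((\<phi> ^^ l) x)"
    then obtain l y where "l < m" "y \<in> carrier N"
        "h = (k, inv\<^bsub>N\<^esub> ((\<phi> ^^ k) y) \<otimes>\<^bsub>N\<^esub> (\<phi> ^^ l) x \<otimes>\<^bsub>N\<^esub> y)"
      unfolding twisted_conjugate_def by blast
    then show "conjugate G h (k, x)"
      using solve unfolding conjugate_def by (metis G_simps(3))
  qed
qed

lemma twisted_conjugate_power:
  assumes x: "x \<in> carrier N" and z: "twisted_conjugate N (\<phi> ^^ k) z x"
  shows "twisted_conjugate N (\<phi> ^^ k) ((\<phi> ^^ n) z) ((\<phi> ^^ n) x)"
proof -
  obtain y where y: "y \<in> carrier N" "z = inv\<^bsub>N\<^esub> ((\<phi> ^^ k) y) \<otimes>\<^bsub>N\<^esub> x \<otimes>\<^bsub>N\<^esub> y"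
    using z by (auto simp: twisted_conjugate_def)
  have "(\<phi> ^^ n) ((\<phi> ^^ k) y) = (\<phi> ^^ k) ((\<phi> ^^ n) y)"
    by (simp add: add.commute flip: power_add)
  then have "(\<phi> ^^ n) z = inv\<^bsub>N\<^esub> ((\<phi> ^^ k) ((\<phi> ^^ n) y)) \<otimes>\<^bsub>N\<^esub> (\<phi> ^^ n) x \<otimes>\<^bsub>N\<^esub> (\<phi> ^^ n) y"
    using x y by (simp add: power_mult power_inv)
  then show ?thesis using y(1) unfolding twisted_conjugate_def by (meson power_closed)
qed

text \<open>The additional twist by \<open>\<phi>\<^sup>l\<close> in the conjugates is invisible to lengths: applying the inverse of
  \<open>\<phi>\<^sup>l\<close> turns a twisted conjugate of \<open>\<phi>\<^sup>l(x)\<close> into a twisted conjugate of \<open>x\<close> of the same length.\<close>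

lemma conjugate_lengths:
  assumes k: "k < m" and x: "x \<in> carrier N"
  shows "{word_length G Y h | h. conjugate G h (k, x)} =
    (+) (stable_length k) ` {word_length N X z | z. twisted_conjugate N (\<phi> ^^ k) z x}"
    (is "?A = ?B")
proof -
  have closed: "z \<in> carrier N" if "twisted_conjugate N (\<phi> ^^ k) z y" "y \<in> carrier N" for z y
    using that by (auto simp: twisted_conjugate_def)
  show ?thesis
  proof
    show "?A \<subseteq> ?B"
    proof
      fix n assume "n \<in> ?A"
      then obtain z l where n: "n = word_length G Y (k, z)"
        and z: "twisted_conjugate N (\<phi> ^^ k) z ((\<phi> ^^ l) x)"
        using conjugate_G_iff[OF assms] by auto
      have zc: "z \<in> carrier N" using closed[OF z] x by simp
      let ?z = "(\<phi> ^^ (l * (m - 1))) z"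
      have "twisted_conjugate N (\<phi> ^^ k) ?z x"
        using twisted_conjugate_power[OF _ z, of "l * (m - 1)"] power_cancel[OF x] x by simp
      moreover have "n = stable_length k + word_length N X ?z"
        using n by (simp add: word_length_G[OF k zc] length_power[OF zc])
      ultimately show "n \<in> ?B" by blast
    qed
    show "?B \<subseteq> ?A"
    proof
      fix n assume "n \<in> ?B"
      then obtain z where z: "twisted_conjugate N (\<phi> ^^ k) z x" and n: "n = stable_length k + word_length N X z"
        by blast
      have "conjugate G (k, z) (k, x)"
        unfolding conjugate_G_iff[OF assms] using z m by (intro exI[of _ z] exI[of _ 0]) simp
      moreover have "n = word_length G Y (k, z)" using n word_length_G[OF k closed[OF z x]] by simp
      ultimately show "n \<in> ?A" by blast
    qed
  qed
qed

text \<open>Both the number of letters outside \<open>X\<close> and the length of the base word have a lower bound, and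
  the minimal length of a conjugate is the sum of these bounds; a sum attains its bound only if
  both summands do.\<close>

lemma ConjGeo_G_iff:
  assumes w: "w \<in> lists Y"
  shows "w \<in> ConjGeo G Y \<longleftrightarrow> stable_count w = stable_length (fst (word_eval G w)) \<and>
    base_word w \<in> twisted_ConjGeo N X (\<phi> ^^ fst (word_eval G w))"
proof -
  let ?x = "word_eval N (base_word w)"
  obtain k where ev: "word_eval G w = (k, ?x)" using snd_eval[OF w] by (metis prod.collapse)
  then have k: "k < m" and x: "?x \<in> carrier N" using eval_Y_closed[OF w] by (auto simp: G_simps)
  let ?S = "{word_length N X z | z. twisted_conjugate N (\<phi> ^^ k) z ?x}"
  have "twisted_conjugate N (\<phi> ^^ k) ?x ?x"
    unfolding twisted_conjugate_def using x by (intro bexI[of _ "\<one>\<^bsub>N\<^esub>"]) auto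
  then have S: "word_length N X ?x \<in> ?S" by blast
  then have "Inf {word_length G Y h | h. conjugate G h (k, ?x)} = stable_length k + Inf ?S"
    unfolding conjugate_lengths[OF k x] by (intro Inf_nat_add_image) blast
  moreover have "Inf ?S \<le> length (base_word w)"
    using cInf_lower[OF S] word_length_le[OF base_word_lists, of N w] by simp
  moreover have "stable_length k \<le> stable_count w" using stable_length_le_count[OF w] ev by simp
  ultimately show ?thesis
    using w base_word_lists[of w] ev length_split[of w]
    by (auto simp: ConjGeo_def twisted_ConjGeo_def)
qed

section \<open>Regularity\<close>

text \<open>The state reached after reading \<open>w\<close>. The count may be cut off at \<open>m\<close> because it is only
  compared with \<open>stable_length k\<close>, which is less than \<open>m\<close>.\<close>

definition profile where
  "profile w = (fst (word_eval G w), min m (stable_count w), split_contexts X (Geo N X) (base_word w))"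

lemma profile_snoc:
  assumes w: "w \<in> lists Y" "w' \<in> lists Y" and a: "a \<in> Y" and eq: "profile w = profile w'"
  shows "profile (w @ [a]) = profile (w' @ [a])"
proof -
  have step: "split_contexts X (Geo N X) (base_word (u @ [a])) \<subseteq> split_contexts X (Geo N X) (base_word (u' @ [a]))"
    if "split_contexts X (Geo N X) (base_word u) \<subseteq> split_contexts X (Geo N X) (base_word u')" for u u'
  proof -
    have mapped: "split_contexts X (Geo N X) (map (\<phi> ^^ fst a) (base_word u))
        \<subseteq> split_contexts X (Geo N X) (map (\<phi> ^^ fst a) (base_word u'))"
      using power_image Geo_map_power base_word_lists base_word_lists that
      by (rule split_contexts_map)
    show ?thesis
    proof (cases "a \<in> base_embed ` X")
      case True
      then have "snd a \<in> X" by (auto simp: base_embed_def)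
      then show ?thesis
        using True split_contexts_snoc[OF _ _ _ mapped] map_power_lists[OF base_word_lists]
        by (simp add: base_word_snoc pull_step_def)
    next
      case False
      then show ?thesis using mapped by (simp add: base_word_snoc pull_step_def)
    qed
  qed
  have "split_contexts X (Geo N X) (base_word (w @ [a])) = split_contexts X (Geo N X) (base_word (w' @ [a]))"
    using step[of w w'] step[of w' w] eq by (simp add: profile_def)
  moreover have "min m (stable_count (w @ [a])) = min m (stable_count (w' @ [a]))"
    using eq by (auto simp: profile_def stable_count_def min_def split: if_splits)
  ultimately show ?thesis using eq w a by (simp add: profile_def fst_eval_snoc)
qed

lemma profile_ConjGeo:
  assumes cyc: "\<And>l. l \<le> m - 1 \<Longrightarrow> twisted_ConjGeo N X (\<phi> ^^ l) = twisted_CycGeo N X (\<phi> ^^ l)"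
    and w: "w \<in> lists Y" "w' \<in> lists Y" and eq: "profile w = profile w'"
    and mem: "w \<in> ConjGeo G Y"
  shows "w' \<in> ConjGeo G Y"
proof -
  define k where "k = fst (word_eval G w)"
  have k': "fst (word_eval G w') = k" using eq by (simp add: profile_def k_def)
  have "k < m" using eval_Y_closed[OF w(1)] unfolding k_def by (cases "word_eval G w") (simp add: G_simps)
  then have k: "k \<le> m - 1" "stable_length k < m" by (auto simp: stable_length_def)
  have c: "stable_count w = stable_length k"
    and "base_word w \<in> twisted_CycGeo N X (\<phi> ^^ k)"
    using mem ConjGeo_G_iff[OF w(1)] cyc[OF k(1)] by (auto simp: k_def)
  then have rot: "map (\<phi> ^^ k) v @ u \<in> Geo N X" if "u @ v = base_word w" for u v
    using that by (auto simp: twisted_CycGeo_iff)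
  have "stable_count w' = stable_length k"
    using eq c k(2) by (auto simp: profile_def min_def split: if_splits)
  moreover have sub: "split_contexts X (Geo N X) (base_word w') \<subseteq> split_contexts X (Geo N X) (base_word w)"
    using eq by (simp add: profile_def)
  have "map (\<phi> ^^ k) v @ u \<in> Geo N X" if "u @ v = base_word w'" for u v
    using power_image Geo_map_power base_word_lists base_word_lists sub rot that
    by (rule split_contexts_rotations)
  then have "base_word w' \<in> twisted_CycGeo N X (\<phi> ^^ k)"
    using base_word_lists by (simp add: twisted_CycGeo_iff)
  ultimately show ?thesis using ConjGeo_G_iff[OF w(2)] cyc[OF k(1)] k' by simp
qed

lemma finite_profiles:
  assumes "regular_language X (Geo N X)"
  shows "finite (profile ` lists Y)"
proof (rule finite_subset)
  show "profile ` lists Y \<subseteq> {..<m} \<times> {..m} \<times> split_contexts X (Geo N X) ` lists X"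
  proof
    fix z assume "z \<in> profile ` lists Y"
    then obtain w where w: "w \<in> lists Y" "z = profile w" by blast
    have "fst (word_eval G w) < m"
      using eval_Y_closed[OF w(1)] by (cases "word_eval G w") (simp add: G_simps)
    then show "z \<in> {..<m} \<times> {..m} \<times> split_contexts X (Geo N X) ` lists X"
      using w(2) base_word_lists[of w] by (simp add: profile_def)
  qed
qed (simp add: finite_split_contexts[OF assms])

end

theorem theorem5p1:
  fixes N :: "('a, 'b) monoid_scheme" and X :: "'a set" and m :: nat and \<phi> :: "'a \<Rightarrow> 'a"
  assumes "group N"
    and "finite X" and "inverse_closed_generating_set N X"
    and "1 \<le> m"
    and "\<phi> \<in> iso N N" and "\<forall>x\<in>carrier N. (\<phi> ^^ m) x = x"
    and "regular_language X (Geo N X)"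
    and "length_preserving N X \<phi>"
    and "\<And>l. l \<le> m - 1 \<Longrightarrow> twisted_ConjGeo N X (\<phi> ^^ l) = twisted_CycGeo N X (\<phi> ^^ l)"
  shows "regular_language (extended_generators N \<phi> m X)
           (ConjGeo (cyclic_semidirect N \<phi> m) (extended_generators N \<phi> m X))"
proof -
  interpret cyclic_extension N X m \<phi>
    using assms by (simp add: cyclic_extension_def cyclic_extension_axioms_def)
  show ?thesis
  proof (rule regular_language_if_right_invariant)
    show "finite (profile ` lists Y)" using assms(7) by (rule finite_profiles)
    show "ConjGeo G Y \<subseteq> lists Y" by (auto simp: ConjGeo_def)
  qed (use profile_snoc profile_ConjGeo[OF assms(9)] in blast)+
qed

end
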